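(* Let $\{\mathcal V_{W\dot W},\mathcal V_{P\dot P}\}$ be $\mathcal E$-linked through $\mathcal V^1_{WP},\mathcal V^2_{\dot W\dot P}$, and let $\mathcal V_W$ be a linear subspace of vectors on $W$. 1. If $\mathcal V_W$ is controlled invariant in $\mathcal V_{W\dot W}$, then $\mathcal V^1_{WP}\leftrightarrow\mathcal V_W$ and $(\mathcal V^2_{\dot W\dot P})_{WP}\leftrightarrow\mathcal V_W$ are controlled invariant in $\mathcal V_{P\dot P}$. 2. If $\mathcal V_W$ is conditioned invariant in $\mathcal V_{W\dot W}$, then $\mathcal V^1_{WP}\leftrightarrow\mathcal V_W$ and $(\mathcal V^2_{\dot W\dot P})_{WP}\leftrightarrow\mathcal V_W$ are conditioned invariant in $\mathcal V_{P\dot P}$. 3. If $\mathcal V_W$ is invariant in $\mathcal V_{W\dot W}$, then $\mathcal V^1_{WP}\leftrightarrow\mathcal V_W$ and $(\mathcal V^2_{\dot W\dot P})_{WP}\leftrightarrow\mathcal V_W$ are invariant in $\mathcal V_{P\dot P}$.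
   Context: Fix a field $\mathbb F$; all index sets are finite. A vector on $X$ is a function $X\to\mathbb F$. $W,\dot W$ are disjoint copies of each other (in bijection), $P,\dot P$ likewise, all four pairwise disjoint; subscripts such as $(\mathcal V^2_{\dot W\dot P})_{WP}$, $(\mathcal V_W)_{\dot W}$ denote relabelling of index sets along bijections. $\mathcal V_{W\dot W}$, $\mathcal V_{P\dot P}$, $\mathcal V^1_{WP}$, $\mathcal V^2_{\dot W\dot P}$ denote linear subspaces of vectors on the indicated disjoint unions. For spaces on sets $X,Y$, $\mathcal V_X\leftrightarrow\mathcal V_Y$ is the space on $(X\setminus Y)\uplus(Y\setminus X)$ of all $(g_{X\setminus Y},h_{Y\setminus X})$ with $g\in\mathcal V_X$, $h\in\mathcal V_Y$ and $g,h$ equal on $X\cap Y$. $\{\mathcal V_{W\dot W},\mathcal V_{P\dot P}\}$ is $\mathcal E$-linked through $\mathcal V^1_{WP},\mathcal V^2_{\dot W\dot P}$ if $\mathcal V^1_{WP}\supseteq(\mathcal V^2_{\dot W\dot P})_{WP}$, $\mathcal V_{W\dot W}=\mathcal V_{P\dot P}\leftrightarrow(\mathcal V^1_{WP}\oplus\mathcal V^2_{\dot W\dot P})$ and $\mathcal V_{P\dot P}=\mathcal V_{W\dot W}\leftrightarrow(\mathcal V^1_{WP}\oplus\mathcal V^2_{\dot W\dot P})$. $\mathcal V_W$ is conditioned invariant in $\mathcal V_{W\dot W}$ iff $\mathcal V_{W\dot W}\leftrightarrow\mathcal V_W\subseteq(\mathcal V_W)_{\dot W}$; controlled invariant iff $\mathcal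 V_{W\dot W}\leftrightarrow(\mathcal V_W)_{\dot W}\supseteq\mathcal V_W$; invariant iff both. (Same for $P,\dot P$.) *)

theory Defs
  imports Complex_Main "HOL-Library.Function_Algebras"
begin

text \<open>
  All index sets are subsets of one type \<open>'i\<close>. A vector on \<open>X\<close>, i.e. a function from \<open>X\<close> to the
  field \<open>'a\<close>, is represented by its extension by zero to \<open>'i\<close>. The set of representatives does not
  determine \<open>X\<close>, so the operations below take the index sets as explicit arguments.
\<close>

definition vectors_on :: "'i set \<Rightarrow> ('i \<Rightarrow> 'a::field) set"
  where "vectors_on X = {f. \<forall>i. i \<notin> X \<longrightarrow> f i = 0}"

interpretation vec: vector_space "\<lambda>(c::'a::field) (f::'i \<Rightarrow> 'a) i. c * f i"
  by unfold_locales (auto simp: fun_eq_iff algebra_simps)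

definition space_on :: "'i set \<Rightarrow> ('i \<Rightarrow> 'a::field) set \<Rightarrow> bool"
  where "space_on X V \<longleftrightarrow> vec.subspace V \<and> V \<subseteq> vectors_on X"

text \<open>\<open>matched_comp X Y V U\<close> is \<open>V \<leftrightarrow> U\<close>, where \<open>V\<close> is a space on \<open>X\<close> and \<open>U\<close> is a space on \<open>Y\<close>.\<close>

definition matched_comp ::
    "'i set \<Rightarrow> 'i set \<Rightarrow> ('i \<Rightarrow> 'a::field) set \<Rightarrow> ('i \<Rightarrow> 'a) set \<Rightarrow> ('i \<Rightarrow> 'a) set"
  where "matched_comp X Y V U =
    {f \<in> vectors_on ((X - Y) \<union> (Y - X)).
       \<exists>g\<in>V. \<exists>h\<in>U. (\<forall>i\<in>X \<inter> Y. g i = h i) \<and>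
         (\<forall>i\<in>X - Y. f i = g i) \<and> (\<forall>i\<in>Y - X. f i = h i)}"

text \<open>For spaces on disjoint index sets, \<open>g + h\<close> is the zero extension of the vector \<open>(g, h)\<close> on the
  disjoint union.\<close>

definition direct_sum :: "('i \<Rightarrow> 'a::field) set \<Rightarrow> ('i \<Rightarrow> 'a) set \<Rightarrow> ('i \<Rightarrow> 'a) set"
  where "direct_sum V U = {g + h | g h. g \<in> V \<and> h \<in> U}"

text \<open>Relabelling of a space on \<open>X\<close> along a map \<open>\<phi>\<close> that is injective on \<open>X\<close>; the result is a space
  on \<open>\<phi> ` X\<close>.\<close>

definition relabel ::
    "('i \<Rightarrow> 'i) \<Rightarrow> 'i set \<Rightarrow> ('i \<Rightarrow> 'a::field) set \<Rightarrow> ('i \<Rightarrow> 'a) set"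
  where "relabel \<phi> X V = {f \<in> vectors_on (\<phi> ` X). \<exists>g\<in>V. \<forall>x\<in>X. f (\<phi> x) = g x}"

text \<open>In the following, \<open>dot\<close> restricts to bijections from \<open>W\<close> to its copy \<open>Wd\<close>, from \<open>P\<close> to \<open>Pd\<close>, and
  from \<open>X\<close> to \<open>Xd\<close>.\<close>

definition E_linked ::
    "('i \<Rightarrow> 'i) \<Rightarrow> 'i set \<Rightarrow> 'i set \<Rightarrow> 'i set \<Rightarrow> 'i set \<Rightarrow>
     ('i \<Rightarrow> 'a::field) set \<Rightarrow> ('i \<Rightarrow> 'a) set \<Rightarrow> ('i \<Rightarrow> 'a) set \<Rightarrow> ('i \<Rightarrow> 'a) set \<Rightarrow> bool"
  where "E_linked dot W Wd P Pd VWWd VPPd V1 V2 \<longleftrightarrow>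
    relabel (inv_into (W \<union> P) dot) (Wd \<union> Pd) V2 \<subseteq> V1 \<and>
    VWWd = matched_comp (P \<union> Pd) ((W \<union> P) \<union> (Wd \<union> Pd)) VPPd (direct_sum V1 V2) \<and>
    VPPd = matched_comp (W \<union> Wd) ((W \<union> P) \<union> (Wd \<union> Pd)) VWWd (direct_sum V1 V2)"

definition conditioned_invariant ::
    "('i \<Rightarrow> 'i) \<Rightarrow> 'i set \<Rightarrow> 'i set \<Rightarrow> ('i \<Rightarrow> 'a::field) set \<Rightarrow> ('i \<Rightarrow> 'a) set \<Rightarrow> bool"
  where "conditioned_invariant dot X Xd VXXd VX \<longleftrightarrow>
    matched_comp (X \<union> Xd) X VXXd VX \<subseteq> relabel dot X VX"

definition controlled_invariant ::
    "('i \<Rightarrow> 'i) \<Rightarrow> 'i set \<Rightarrow> 'i set \<Rightarrow> ('i \<Rightarrow> 'a::field) set \<Rightarrow> ('i \<Rightarrow> 'a) set \<Rightarrow> bool"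
  where "controlled_invariant dot X Xd VXXd VX \<longleftrightarrow>
    VX \<subseteq> matched_comp (X \<union> Xd) Xd VXXd (relabel dot X VX)"

definition invariant ::
    "('i \<Rightarrow> 'i) \<Rightarrow> 'i set \<Rightarrow> 'i set \<Rightarrow> ('i \<Rightarrow> 'a::field) set \<Rightarrow> ('i \<Rightarrow> 'a) set \<Rightarrow> bool"
  where "invariant dot X Xd VXXd VX \<longleftrightarrow>
    conditioned_invariant dot X Xd VXXd VX \<and> controlled_invariant dot X Xd VXXd VX"

lemma space_on_relabel:
  assumes "space_on X V"
  shows "space_on (\<phi> ` X) (relabel \<phi> X V)"
proof -
  have V: "vec.subspace V"
    using assms by (auto simp: space_on_def)
  have "vec.subspace (relabel \<phi> X V)"
  proof (rule vec.subspaceI)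
    show "0 \<in> relabel \<phi> X V"
      using vec.subspace_0[OF V] unfolding relabel_def vectors_on_def
      by (intro CollectI conjI bexI[of _ 0]) auto
  next
    fix f f' assume "f \<in> relabel \<phi> X V" "f' \<in> relabel \<phi> X V"
    then obtain g g' where
      *: "f \<in> vectors_on (\<phi> ` X)" "f' \<in> vectors_on (\<phi> ` X)" "g \<in> V" "g' \<in> V"
        "\<forall>x\<in>X. f (\<phi> x) = g x" "\<forall>x\<in>X. f' (\<phi> x) = g' x"
      by (auto simp: relabel_def)
    have "g + g' \<in> V"
      using * vec.subspace_add[OF V] by auto
    then show "f + f' \<in> relabel \<phi> X V"
      using * unfolding relabel_def vectors_on_def
      by (intro CollectI conjI bexI[of _ "g + g'"]) auto
  next
    fix c :: 'b and f assume "f \<in> relabel \<phi> X V"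
    then obtain g where
      *: "f \<in> vectors_on (\<phi> ` X)" "g \<in> V" "\<forall>x\<in>X. f (\<phi> x) = g x"
      by (auto simp: relabel_def)
    have "(\<lambda>i. c * g i) \<in> V"
      using * vec.subspace_scale[OF V] by auto
    then show "(\<lambda>i. c * f i) \<in> relabel \<phi> X V"
      using * unfolding relabel_def vectors_on_def
      by (intro CollectI conjI bexI[of _ "\<lambda>i. c * g i"]) auto
  qed
  then show ?thesis by (auto simp: space_on_def relabel_def)
qed

lemma space_on_matched_comp:
  assumes "space_on X V" "space_on Y U"
  shows "space_on ((X - Y) \<union> (Y - X)) (matched_comp X Y V U)"
proof -
  have V: "vec.subspace V" and U: "vec.subspace U"
    using assms by (auto simp: space_on_def)
  have "vec.subspace (matched_comp X Y V U)"
  proof (rule vec.subspaceI)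
    show "0 \<in> matched_comp X Y V U"
      using vec.subspace_0[OF V] vec.subspace_0[OF U]
      unfolding matched_comp_def vectors_on_def
      by (intro CollectI conjI bexI[of _ 0]) auto
  next
    fix f f' assume "f \<in> matched_comp X Y V U" "f' \<in> matched_comp X Y V U"
    then obtain g h g' h' where
      *: "f \<in> vectors_on ((X - Y) \<union> (Y - X))" "f' \<in> vectors_on ((X - Y) \<union> (Y - X))"
        "g \<in> V" "h \<in> U" "g' \<in> V" "h' \<in> U"
        "\<forall>i\<in>X \<inter> Y. g i = h i" "\<forall>i\<in>X - Y. f i = g i" "\<forall>i\<in>Y - X. f i = h i"
        "\<forall>i\<in>X \<inter> Y. g' i = h' i" "\<forall>i\<in>X - Y. f' i = g' i" "\<forall>i\<in>Y - X. f' i = h' i"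
      by (auto simp: matched_comp_def)
    have "g + g' \<in> V" "h + h' \<in> U"
      using * vec.subspace_add[OF V] vec.subspace_add[OF U] by auto
    then show "f + f' \<in> matched_comp X Y V U"
      using * unfolding matched_comp_def vectors_on_def
      by (intro CollectI conjI bexI[of _ "g + g'"] bexI[of _ "h + h'"]) auto
  next
    fix c :: 'b and f assume "f \<in> matched_comp X Y V U"
    then obtain g h where
      *: "f \<in> vectors_on ((X - Y) \<union> (Y - X))" "g \<in> V" "h \<in> U"
        "\<forall>i\<in>X \<inter> Y. g i = h i" "\<forall>i\<in>X - Y. f i = g i" "\<forall>i\<in>Y - X. f i = h i"
      by (auto simp: matched_comp_def)
    have "(\<lambda>i. c * g i) \<in> V" "(\<lambda>i. c * h i) \<in> U"
      using * vec.subspace_scale[OF V] vec.subspace_scale[OF U] by auto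
    then show "(\<lambda>i. c * f i) \<in> matched_comp X Y V U"
      using * unfolding matched_comp_def vectors_on_def
      by (intro CollectI conjI bexI[of _ "\<lambda>i. c * g i"] bexI[of _ "\<lambda>i. c * h i"]) auto
  qed
  then show ?thesis by (auto simp: space_on_def matched_comp_def)
qed

end

theory Submission
  imports Defs
begin

text \<open>
  Identify the dotted copies with the originals and read each space as a relation: \<open>VWWd\<close> is a
  relation from \<open>w\<close> to \<open>w'\<close>, \<open>VPPd\<close> from \<open>p\<close> to \<open>p'\<close>, and \<open>V1 \<supseteq> V2\<close> are two relations between \<open>W\<close>
  and \<open>P\<close>. The linking condition says that \<open>w \<rightarrow> w'\<close> iff there are \<open>p \<rightarrow> p'\<close> with \<open>(w, p) \<in> V1\<close> and
  \<open>(w', p') \<in> V2\<close>, and that \<open>p \<rightarrow> p'\<close> iff there are such \<open>w \<rightarrow> w'\<close>. Controlled invariance of \<open>VW\<close>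
  means that every vector of \<open>VW\<close> has a successor in \<open>VW\<close>, conditioned invariance that all its
  successors lie in \<open>VW\<close>. The spaces \<open>V1 \<leftrightarrow> VW\<close> and \<open>V2 \<leftrightarrow> VW\<close> are the images of \<open>VW\<close> under \<open>V1\<close>
  and \<open>V2\<close>, and the second is contained in the first.

  Since the two halves of the linking condition hold at once, a step can be transported to any
  partner of its start and any partner of its end:
  \<^item> Controlled: let \<open>(w, p) \<in> V1\<close> with \<open>w \<in> VW\<close>, and let \<open>w \<rightarrow> w' \<in> VW\<close>. The step \<open>w \<rightarrow> w'\<close> comes
    with some \<open>p'\<close> such that \<open>(w', p') \<in> V2\<close>. The second half, applied to \<open>(w, p)\<close> and \<open>(w', p')\<close>,
    gives \<open>p \<rightarrow> p'\<close>, and \<open>p'\<close> is in the image of \<open>VW\<close> under \<open>V2\<close>.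
  \<^item> Conditioned: let \<open>(w, p) \<in> V1\<close> with \<open>w \<in> VW\<close>, and let \<open>p \<rightarrow> p'\<close>. This step comes with some
    \<open>w'\<close> such that \<open>(w', p') \<in> V2\<close>. The first half gives \<open>w \<rightarrow> w'\<close>, hence \<open>w' \<in> VW\<close>, and again \<open>p'\<close>
    is in the image of \<open>VW\<close> under \<open>V2\<close>.

  Thus steps from the larger image, under \<open>V1\<close>, can be made to end, or always end, in the smaller
  one, under \<open>V2\<close>. This settles both images together, and in fact every set between them
  (\<open>controlled_invariant_between\<close> and \<open>conditioned_invariant_between\<close>). What remains is bookkeeping
  about zero extensions, where \<open>x + y\<close> plays the role of the pair \<open>(x, y)\<close>, and the fact that
  taking images is compatible with relabelling.
\<close>

section \<open>Pairs of zero-extended vectors\<close>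

lemma vectors_on_Un_split:
  assumes "f \<in> vectors_on (X \<union> Y)" "X \<inter> Y = {}"
  obtains x y where "x \<in> vectors_on X" "y \<in> vectors_on Y" "f = x + y"
proof
  show "(\<lambda>i. if i \<in> X then f i else 0) \<in> vectors_on X"
    and "(\<lambda>i. if i \<in> Y then f i else 0) \<in> vectors_on Y"
    by (auto simp: vectors_on_def)
  show "f = (\<lambda>i. if i \<in> X then f i else 0) + (\<lambda>i. if i \<in> Y then f i else 0)"
    using assms by (auto simp: vectors_on_def fun_eq_iff)
qed

lemma vectors_on_add:
  assumes "x \<in> vectors_on X" "y \<in> vectors_on Y"
  shows "x + y \<in> vectors_on (X \<union> Y)"
  using assms by (auto simp: vectors_on_def)

lemma vectors_on_add_cancel:
  assumes "X \<inter> Y = {}" "x \<in> vectors_on X" "x' \<in> vectors_on X"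
    and "y \<in> vectors_on Y" "y' \<in> vectors_on Y" "x + y = x' + y'"
  shows "x = x'" "y = y'"
proof -
  have sum: "x i + y i = x' i + y' i" for i
    using fun_cong[OF assms(6), of i] by simp
  have outside: "(x i = 0 \<and> x' i = 0) \<or> (y i = 0 \<and> y' i = 0)" for i
    using assms(1-5) by (auto simp: vectors_on_def)
  show "x = x'"
  proof
    fix i show "x i = x' i"
      using sum[of i] outside[of i] by auto
  qed
  show "y = y'"
  proof
    fix i show "y i = y' i"
      using sum[of i] outside[of i] by auto
  qed
qed

lemma add_mem_direct_sum_iff:
  assumes "X \<inter> Y = {}" "V \<subseteq> vectors_on X" "U \<subseteq> vectors_on Y"
    and "x \<in> vectors_on X" "y \<in> vectors_on Y"
  shows "x + y \<in> direct_sum V U \<longleftrightarrow> x \<in> V \<and> y \<in> U"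
proof
  assume "x + y \<in> direct_sum V U"
  then obtain g h where gh: "g \<in> V" "h \<in> U" and sum: "x + y = g + h"
    by (auto simp: direct_sum_def)
  have "g \<in> vectors_on X" "h \<in> vectors_on Y"
    using gh assms(2,3) by auto
  then have "x = g" "y = h"
    using vectors_on_add_cancel[OF assms(1) assms(4) _ assms(5) _ sum] by simp_all
  with gh show "x \<in> V \<and> y \<in> U" by simp
next
  assume "x \<in> V \<and> y \<in> U"
  then show "x + y \<in> direct_sum V U"
    unfolding direct_sum_def by blast
qed

section \<open>Matched composition as the image under a relation\<close>

lemma matched_comp_commute: "matched_comp X Y V U = matched_comp Y X U V"
proof -
  have "matched_comp X Y V U \<subseteq> matched_comp Y X U V"
    for X Y :: "'j set" and V U :: "('j \<Rightarrow> 'b::field) set"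
  proof
    fix f assume "f \<in> matched_comp X Y V U"
    then obtain g h where f: "f \<in> vectors_on ((X - Y) \<union> (Y - X))" and gh: "g \<in> V" "h \<in> U"
      and "\<forall>i\<in>X \<inter> Y. g i = h i" "\<forall>i\<in>X - Y. f i = g i" "\<forall>i\<in>Y - X. f i = h i"
      unfolding matched_comp_def by blast
    then have "(\<forall>i\<in>Y \<inter> X. h i = g i) \<and> (\<forall>i\<in>Y - X. f i = h i) \<and> (\<forall>i\<in>X - Y. f i = g i)"
      by simp
    moreover have "f \<in> vectors_on ((Y - X) \<union> (X - Y))"
      using f by (subst Un_commute)
    ultimately show "f \<in> matched_comp Y X U V"
      using gh unfolding matched_comp_def by blast
  qed
  then show ?thesis by (intro equalityI)
qed

lemma matched_comp_mono: "V \<subseteq> V' \<Longrightarrow> matched_comp X Y V U \<subseteq> matched_comp X Y V' U"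
  unfolding matched_comp_def by blast

text \<open>When one index set contains the other, matched composition is the image of the smaller space
  under the larger one, read as a relation.\<close>

lemma mem_matched_comp_iff:
  assumes "X \<inter> Y = {}" "V \<subseteq> vectors_on (X \<union> Y)" "U \<subseteq> vectors_on X"
  shows "y \<in> matched_comp (X \<union> Y) X V U \<longleftrightarrow> y \<in> vectors_on Y \<and> (\<exists>x\<in>U. x + y \<in> V)"
proof -
  have sets: "(X \<union> Y - X) \<union> (X - (X \<union> Y)) = Y" "(X \<union> Y) \<inter> X = X" "X \<union> Y - X = Y"
      "X - (X \<union> Y) = {}"
    using assms(1) by auto
  have split: "g = h + y \<longleftrightarrow> (\<forall>i\<in>X. g i = h i) \<and> (\<forall>i\<in>Y. y i = g i)"
    if "g \<in> V" "h \<in> U" "y \<in> vectors_on Y" for g h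
  proof -
    have g0: "g i = 0" if "i \<notin> X" "i \<notin> Y" for i
      using that \<open>g \<in> V\<close> assms(2) by (auto simp: vectors_on_def)
    have h0: "h i = 0" if "i \<notin> X" for i
      using that \<open>h \<in> U\<close> assms(3) by (auto simp: vectors_on_def)
    have y0: "y i = 0" if "i \<notin> Y" for i
      using that \<open>y \<in> vectors_on Y\<close> by (auto simp: vectors_on_def)
    show ?thesis
    proof
      assume g: "g = h + y"
      show "(\<forall>i\<in>X. g i = h i) \<and> (\<forall>i\<in>Y. y i = g i)"
      proof (intro conjI ballI)
        fix i assume "i \<in> X"
        with assms(1) have "i \<notin> Y" by auto
        with g y0 show "g i = h i" by simp
      next
        fix i assume "i \<in> Y"
        with assms(1) have "i \<notin> X" by auto
        with g h0 show "y i = g i" by simp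
      qed
    next
      assume gh: "(\<forall>i\<in>X. g i = h i) \<and> (\<forall>i\<in>Y. y i = g i)"
      show "g = h + y"
      proof
        fix i show "g i = (h + y) i"
          using gh g0[of i] h0[of i] y0[of i] assms(1)
          by (cases "i \<in> X"; cases "i \<in> Y") auto
      qed
    qed
  qed
  have "y \<in> matched_comp (X \<union> Y) X V U \<longleftrightarrow>
      y \<in> vectors_on Y \<and> (\<exists>g\<in>V. \<exists>h\<in>U. (\<forall>i\<in>X. g i = h i) \<and> (\<forall>i\<in>Y. y i = g i))"
    unfolding matched_comp_def sets by simp
  also have "\<dots> \<longleftrightarrow> y \<in> vectors_on Y \<and> (\<exists>g\<in>V. \<exists>h\<in>U. g = h + y)"
    using split by blast
  finally show ?thesis by blast
qed

section \<open>Relabelling\<close>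

lemma relabel_mono: "V \<subseteq> V' \<Longrightarrow> relabel \<phi> X V \<subseteq> relabel \<phi> X V'"
  unfolding relabel_def by blast

lemma relabel_subset_vectors_on: "relabel \<phi> X V \<subseteq> vectors_on (\<phi> ` X)"
  by (auto simp: relabel_def)

text \<open>Renaming both components of a pair in \<open>V2\<close> gives a pair in the undotted \<open>V2\<close>, so the image of
  the dotted copy of \<open>VW\<close> lies in the dotted copy of an image of \<open>VW\<close>. This brings the ends of
  steps, which carry dotted indices, back into the set under study.\<close>

lemma matched_comp_relabel_subset:
  assumes W: "bij_betw dot W Wd" and P: "bij_betw dot P Pd"
    and disj: "W \<inter> P = {}" "Wd \<inter> Pd = {}"
    and V2: "V2 \<subseteq> vectors_on (Wd \<union> Pd)" and VW: "VW \<subseteq> vectors_on W"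
  shows "matched_comp (Wd \<union> Pd) Wd V2 (relabel dot W VW) \<subseteq>
    relabel dot P (matched_comp (W \<union> P) W (relabel (inv_into (W \<union> P) dot) (Wd \<union> Pd) V2) VW)"
proof
  let ?inv = "inv_into (W \<union> P) dot"
  have WP: "bij_betw dot (W \<union> P) (Wd \<union> Pd)"
    using bij_betw_combine[OF W P] disj by simp
  have inv_image: "?inv ` (Wd \<union> Pd) = W \<union> P"
    using bij_betw_inv_into[OF WP] by (simp add: bij_betw_def)
  have inv_dot: "?inv (dot i) = i" if "i \<in> W \<union> P" for i
    using that WP by (simp add: bij_betw_def inv_into_f_f)
  have dot_image: "dot ` W = Wd" "dot ` P = Pd"
    using W P by (auto simp: bij_betw_def)
  have U: "relabel ?inv (Wd \<union> Pd) V2 \<subseteq> vectors_on (W \<union> P)"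
    using relabel_subset_vectors_on[of ?inv "Wd \<union> Pd" V2] inv_image by simp
  have rW: "relabel dot W VW \<subseteq> vectors_on Wd"
    using relabel_subset_vectors_on[of dot W VW] dot_image by simp
  fix y assume "y \<in> matched_comp (Wd \<union> Pd) Wd V2 (relabel dot W VW)"
  then obtain x where y: "y \<in> vectors_on Pd" and x: "x \<in> relabel dot W VW" and xy: "x + y \<in> V2"
    unfolding mem_matched_comp_iff[OF disj(2) V2 rW] by blast
  from x rW obtain g where xWd: "x \<in> vectors_on Wd" and g: "g \<in> VW" "\<forall>i\<in>W. x (dot i) = g i"
    by (auto simp: relabel_def)
  define h where "h i = (if i \<in> P then y (dot i) else 0)" for i
  have h: "h \<in> vectors_on P" by (simp add: h_def vectors_on_def)
  have gW: "g \<in> vectors_on W" using g VW by blast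
  have "(g + h) (?inv (dot i)) = (x + y) (dot i)" if i: "i \<in> W \<union> P" for i
  proof (cases "i \<in> W")
    case True
    then have "i \<notin> P" "dot i \<notin> Pd" using disj dot_image by auto
    then show ?thesis using True g y i by (simp add: inv_dot h_def vectors_on_def)
  next
    case False
    then have "i \<in> P" "dot i \<notin> Wd" using i disj dot_image by auto
    then show ?thesis using False gW xWd i by (simp add: inv_dot h_def vectors_on_def)
  qed
  then have "\<forall>z\<in>Wd \<union> Pd. (g + h) (?inv z) = (x + y) z"
    using dot_image by auto
  moreover have "g + h \<in> vectors_on (?inv ` (Wd \<union> Pd))"
    using vectors_on_add[OF gW h] inv_image by simp
  ultimately have "g + h \<in> relabel ?inv (Wd \<union> Pd) V2"
    using xy unfolding relabel_def by blast
  then have "h \<in> matched_comp (W \<union> P) W (relabel ?inv (Wd \<union> Pd) V2) VW"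
    unfolding mem_matched_comp_iff[OF disj(1) U VW] using g h by blast
  then show "y \<in> relabel dot P (matched_comp (W \<union> P) W (relabel ?inv (Wd \<union> Pd) V2) VW)"
    using y unfolding relabel_def dot_image by (auto simp: h_def intro!: bexI[of _ h])
qed

section \<open>Invariance and linking in terms of steps\<close>

lemma conditioned_invariant_iff:
  assumes "X \<inter> Xd = {}" "VXXd \<subseteq> vectors_on (X \<union> Xd)" "VX \<subseteq> vectors_on X"
  shows "conditioned_invariant dot X Xd VXXd VX \<longleftrightarrow>
    (\<forall>x\<in>VX. \<forall>y\<in>vectors_on Xd. x + y \<in> VXXd \<longrightarrow> y \<in> relabel dot X VX)"
  unfolding conditioned_invariant_def subset_iff mem_matched_comp_iff[OF assms] by blast

lemma controlled_invariant_iff: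
  assumes "bij_betw dot X Xd" "X \<inter> Xd = {}" "VXXd \<subseteq> vectors_on (X \<union> Xd)"
    and "VX \<subseteq> vectors_on X"
  shows "controlled_invariant dot X Xd VXXd VX \<longleftrightarrow>
    (\<forall>x\<in>VX. \<exists>y\<in>relabel dot X VX. x + y \<in> VXXd)"
proof -
  have "relabel dot X VX \<subseteq> vectors_on Xd"
    using relabel_subset_vectors_on[of dot X VX] assms(1) by (simp add: bij_betw_def)
  moreover have "Xd \<inter> X = {}" "VXXd \<subseteq> vectors_on (Xd \<union> X)"
    using assms(2,3) by (simp_all add: Int_commute Un_commute)
  ultimately have "x \<in> matched_comp (X \<union> Xd) Xd VXXd (relabel dot X VX) \<longleftrightarrow>
      x \<in> vectors_on X \<and> (\<exists>y\<in>relabel dot X VX. x + y \<in> VXXd)" for x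
    using mem_matched_comp_iff[of Xd X VXXd "relabel dot X VX" x]
    by (simp add: Un_commute add.commute)
  then show ?thesis
    unfolding controlled_invariant_def subset_iff using assms(4) by blast
qed

text \<open>Either half of the linking condition, as a statement about steps. It is symmetric in the two
  systems up to the order of the summands, so it serves for both halves.\<close>

lemma add_mem_linked_iff:
  assumes disj: "W \<inter> Wd = {}" "W \<inter> P = {}" "W \<inter> Pd = {}"
      "Wd \<inter> P = {}" "Wd \<inter> Pd = {}" "P \<inter> Pd = {}"
    and B: "B \<subseteq> vectors_on (P \<union> Pd)"
    and V1: "V1 \<subseteq> vectors_on (W \<union> P)" and V2: "V2 \<subseteq> vectors_on (Wd \<union> Pd)"
    and w: "w \<in> vectors_on W" and w': "w' \<in> vectors_on Wd"
  shows "w + w' \<in> matched_comp (P \<union> Pd) ((W \<union> P) \<union> (Wd \<union> Pd)) B (direct_sum V1 V2) \<longleftrightarrow>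
    (\<exists>p\<in>vectors_on P. \<exists>p'\<in>vectors_on Pd. p + p' \<in> B \<and> w + p \<in> V1 \<and> w' + p' \<in> V2)"
proof -
  have idx: "(P \<union> Pd) \<union> (W \<union> Wd) = (W \<union> P) \<union> (Wd \<union> Pd)" by auto
  have "(P \<union> Pd) \<inter> (W \<union> Wd) = {}" and disj': "(W \<union> P) \<inter> (Wd \<union> Pd) = {}"
    using disj by auto
  moreover have "direct_sum V1 V2 \<subseteq> vectors_on ((P \<union> Pd) \<union> (W \<union> Wd))"
    unfolding idx direct_sum_def using V1 V2 by (auto intro!: vectors_on_add)
  ultimately have "w + w' \<in> matched_comp (P \<union> Pd) ((W \<union> P) \<union> (Wd \<union> Pd)) B (direct_sum V1 V2)
      \<longleftrightarrow> (\<exists>b\<in>B. b + (w + w') \<in> direct_sum V1 V2)"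
    using mem_matched_comp_iff[of "P \<union> Pd" "W \<union> Wd" "direct_sum V1 V2" B "w + w'"]
      B vectors_on_add[OF w w'] idx
    by (simp add: matched_comp_commute[of "P \<union> Pd"])
  also have "\<dots> \<longleftrightarrow> (\<exists>p\<in>vectors_on P. \<exists>p'\<in>vectors_on Pd. p + p' \<in> B \<and>
      (p + p') + (w + w') \<in> direct_sum V1 V2)"
  proof
    assume "\<exists>b\<in>B. b + (w + w') \<in> direct_sum V1 V2"
    then obtain b where b: "b \<in> B" "b + (w + w') \<in> direct_sum V1 V2" by blast
    moreover obtain p p' where "p \<in> vectors_on P" "p' \<in> vectors_on Pd" "b = p + p'"
      using vectors_on_Un_split[of b P Pd] b(1) B disj(6) by blast
    ultimately show "\<exists>p\<in>vectors_on P. \<exists>p'\<in>vectors_on Pd. p + p' \<in> B \<and>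
        (p + p') + (w + w') \<in> direct_sum V1 V2"
      by blast
  qed blast
  also have "\<dots> \<longleftrightarrow>
      (\<exists>p\<in>vectors_on P. \<exists>p'\<in>vectors_on Pd. p + p' \<in> B \<and> w + p \<in> V1 \<and> w' + p' \<in> V2)"
  proof -
    have "(p + p') + (w + w') \<in> direct_sum V1 V2 \<longleftrightarrow> w + p \<in> V1 \<and> w' + p' \<in> V2"
      if "p \<in> vectors_on P" "p' \<in> vectors_on Pd" for p p'
    proof -
      have "(p + p') + (w + w') = (w + p) + (w' + p')" by (simp add: ac_simps)
      then show ?thesis
        using add_mem_direct_sum_iff[OF disj' V1 V2] vectors_on_add w w' that by metis
    qed
    then show ?thesis by blast
  qed
  finally show ?thesis .
qed

lemma E_linkedD:
  assumes "E_linked dot W Wd P Pd VWWd VPPd V1 V2"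
  shows "relabel (inv_into (W \<union> P) dot) (Wd \<union> Pd) V2 \<subseteq> V1"
    and "matched_comp (P \<union> Pd) ((W \<union> P) \<union> (Wd \<union> Pd)) VPPd (direct_sum V1 V2) = VWWd"
    and "matched_comp (W \<union> Wd) ((W \<union> P) \<union> (Wd \<union> Pd)) VWWd (direct_sum V1 V2) = VPPd"
proof -
  \<comment> \<open>The two equations form a rewriting cycle, so they are separated without simplification.\<close>
  note linked = assms[unfolded E_linked_def]
  show "relabel (inv_into (W \<union> P) dot) (Wd \<union> Pd) V2 \<subseteq> V1"
    by (rule linked[THEN conjunct1])
  show "matched_comp (P \<union> Pd) ((W \<union> P) \<union> (Wd \<union> Pd)) VPPd (direct_sum V1 V2) = VWWd"
    by (rule linked[THEN conjunct2, THEN conjunct1, symmetric])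
  show "matched_comp (W \<union> Wd) ((W \<union> P) \<union> (Wd \<union> Pd)) VWWd (direct_sum V1 V2) = VPPd"
    by (rule linked[THEN conjunct2, THEN conjunct2, symmetric])
qed

section \<open>Transport of invariant spaces\<close>

text \<open>The following context holds the two halves of the linking condition. Its lemmas treat any set
  \<open>K\<close> between the images of \<open>VW\<close> under \<open>V2\<close> and under \<open>V1\<close>.\<close>

context
  fixes W Wd P Pd :: "'i set" and dot :: "'i \<Rightarrow> 'i"
    and VWWd VPPd V1 V2 VW K :: "('i \<Rightarrow> 'a::field) set"
  assumes bij: "bij_betw dot W Wd" "bij_betw dot P Pd"
    and disj: "W \<inter> Wd = {}" "W \<inter> P = {}" "W \<inter> Pd = {}"
      "Wd \<inter> P = {}" "Wd \<inter> Pd = {}" "P \<inter> Pd = {}"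
    and A: "VWWd \<subseteq> vectors_on (W \<union> Wd)" and B: "VPPd \<subseteq> vectors_on (P \<union> Pd)"
    and V1: "V1 \<subseteq> vectors_on (W \<union> P)" and V2: "V2 \<subseteq> vectors_on (Wd \<union> Pd)"
    and linked: "E_linked dot W Wd P Pd VWWd VPPd V1 V2"
    and VW: "VW \<subseteq> vectors_on W"
    and K_lower:
      "matched_comp (W \<union> P) W (relabel (inv_into (W \<union> P) dot) (Wd \<union> Pd) V2) VW \<subseteq> K"
    and K_upper: "K \<subseteq> matched_comp (W \<union> P) W V1 VW"
begin

lemma step_W_iff:
  assumes "w \<in> vectors_on W" "w' \<in> vectors_on Wd"
  shows "w + w' \<in> VWWd \<longleftrightarrow>
    (\<exists>p\<in>vectors_on P. \<exists>p'\<in>vectors_on Pd. p + p' \<in> VPPd \<and> w + p \<in> V1 \<and> w' + p' \<in> V2)"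
  using add_mem_linked_iff[OF disj B V1 V2 assms] unfolding E_linkedD(2)[OF linked] .

lemma step_P_iff:
  assumes "p \<in> vectors_on P" "p' \<in> vectors_on Pd"
  shows "p + p' \<in> VPPd \<longleftrightarrow>
    (\<exists>w\<in>vectors_on W. \<exists>w'\<in>vectors_on Wd. w + w' \<in> VWWd \<and> w + p \<in> V1 \<and> w' + p' \<in> V2)"
proof -
  have "P \<inter> Pd = {}" "P \<inter> W = {}" "P \<inter> Wd = {}" "Pd \<inter> W = {}" "Pd \<inter> Wd = {}" "W \<inter> Wd = {}"
    and "V1 \<subseteq> vectors_on (P \<union> W)" "V2 \<subseteq> vectors_on (Pd \<union> Wd)"
    using disj V1 V2 by (auto simp: Un_commute)
  note half = add_mem_linked_iff[OF this(1-6) A this(7,8) assms]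
  have "matched_comp (W \<union> Wd) ((P \<union> W) \<union> (Pd \<union> Wd)) VWWd (direct_sum V1 V2) = VPPd"
    using E_linkedD(3)[OF linked] by (simp only: Un_commute)
  with half show ?thesis by (simp add: add.commute)
qed

lemma mem_upperE:
  assumes "p \<in> K"
  obtains w where "p \<in> vectors_on P" "w \<in> VW" "w \<in> vectors_on W" "w + p \<in> V1"
proof -
  have "p \<in> matched_comp (W \<union> P) W V1 VW" using assms K_upper by blast
  then show thesis
    unfolding mem_matched_comp_iff[OF disj(2) V1 VW] using VW that by blast
qed

lemma K_subset: "K \<subseteq> vectors_on P"
  by (blast elim: mem_upperE)

lemma mem_relabel_K:
  assumes "w' \<in> relabel dot W VW" "p' \<in> vectors_on Pd" "w' + p' \<in> V2"
  shows "p' \<in> relabel dot P K"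
proof -
  have "relabel dot W VW \<subseteq> vectors_on Wd"
    using relabel_subset_vectors_on[of dot W VW] bij by (simp add: bij_betw_def)
  then have "p' \<in> matched_comp (Wd \<union> Pd) Wd V2 (relabel dot W VW)"
    using mem_matched_comp_iff[OF disj(5) V2] assms by blast
  then show ?thesis
    using matched_comp_relabel_subset[OF bij disj(2,5) V2 VW] relabel_mono[OF K_lower] by blast
qed

lemma controlled_invariant_between:
  assumes "controlled_invariant dot W Wd VWWd VW"
  shows "controlled_invariant dot P Pd VPPd K"
  unfolding controlled_invariant_iff[OF bij(2) disj(6) B K_subset]
proof
  fix p assume "p \<in> K"
  then obtain w where p: "p \<in> vectors_on P" and w: "w \<in> VW" "w \<in> vectors_on W" "w + p \<in> V1"
    by (rule mem_upperE)
  from assms w obtain w' where w': "w' \<in> relabel dot W VW" "w + w' \<in> VWWd"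
    unfolding controlled_invariant_iff[OF bij(1) disj(1) A VW] by blast
  have w'Wd: "w' \<in> vectors_on Wd"
    using w'(1) relabel_subset_vectors_on[of dot W VW] bij by (auto simp: bij_betw_def)
  from w'(2) obtain p' where p': "p' \<in> vectors_on Pd" "w' + p' \<in> V2"
    unfolding step_W_iff[OF w(2) w'Wd] by blast
  \<comment> \<open>The start of the \<open>P\<close>-step belonging to \<open>w + w'\<close> may differ from \<open>p\<close>; linking in the other
    direction replaces it by \<open>p\<close>.\<close>
  have "p + p' \<in> VPPd"
    unfolding step_P_iff[OF p p'(1)] using w w' w'Wd p' by blast
  then show "\<exists>p'\<in>relabel dot P K. p + p' \<in> VPPd"
    using mem_relabel_K[OF w'(1) p'] by blast
qed

lemma conditioned_invariant_between:
  assumes "conditioned_invariant dot W Wd VWWd VW"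
  shows "conditioned_invariant dot P Pd VPPd K"
  unfolding conditioned_invariant_iff[OF disj(6) B K_subset]
proof (intro ballI impI)
  fix p p' assume "p \<in> K" and p': "p' \<in> vectors_on Pd" and step: "p + p' \<in> VPPd"
  from \<open>p \<in> K\<close> obtain w where p: "p \<in> vectors_on P"
    and w: "w \<in> VW" "w \<in> vectors_on W" "w + p \<in> V1"
    by (rule mem_upperE)
  from step obtain w' where w': "w' \<in> vectors_on Wd" "w' + p' \<in> V2"
    unfolding step_P_iff[OF p p'] by blast
  \<comment> \<open>The start of the \<open>W\<close>-step belonging to \<open>p + p'\<close> need not lie in \<open>VW\<close>; linking in the other
    direction replaces it by \<open>w\<close>.\<close>
  have "w + w' \<in> VWWd"
    unfolding step_W_iff[OF w(2) w'(1)] using p p' step w w' by blast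
  then have "w' \<in> relabel dot W VW"
    using assms w w' unfolding conditioned_invariant_iff[OF disj(1) A VW] by blast
  then show "p' \<in> relabel dot P K"
    using mem_relabel_K p' w'(2) by blast
qed

end

theorem theorem75:
  fixes W Wd P Pd :: "'i set"
    and dot :: "'i \<Rightarrow> 'i"
    and VWWd VPPd V1 V2 VW :: "('i \<Rightarrow> 'a::field) set"
  assumes "finite W" "finite Wd" "finite P" "finite Pd"
    and "bij_betw dot W Wd" "bij_betw dot P Pd"
    and "W \<inter> Wd = {}" "W \<inter> P = {}" "W \<inter> Pd = {}"
      "Wd \<inter> P = {}" "Wd \<inter> Pd = {}" "P \<inter> Pd = {}"
    and "space_on (W \<union> Wd) VWWd" "space_on (P \<union> Pd) VPPd"
    and "space_on (W \<union> P) V1" "space_on (Wd \<union> Pd) V2"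
    and "E_linked dot W Wd P Pd VWWd VPPd V1 V2"
    and "space_on W VW"
  shows "(controlled_invariant dot W Wd VWWd VW \<longrightarrow>
           controlled_invariant dot P Pd VPPd
             (matched_comp (W \<union> P) W V1 VW) \<and>
           controlled_invariant dot P Pd VPPd
             (matched_comp (W \<union> P) W (relabel (inv_into (W \<union> P) dot) (Wd \<union> Pd) V2) VW)) \<and>
         (conditioned_invariant dot W Wd VWWd VW \<longrightarrow>
           conditioned_invariant dot P Pd VPPd
             (matched_comp (W \<union> P) W V1 VW) \<and>
           conditioned_invariant dot P Pd VPPd
             (matched_comp (W \<union> P) W (relabel (inv_into (W \<union> P) dot) (Wd \<union> Pd) V2) VW)) \<and>
         (invariant dot W Wd VWWd VW \<longrightarrow>
           invariant dot P Pd VPPd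
             (matched_comp (W \<union> P) W V1 VW) \<and>
           invariant dot P Pd VPPd
             (matched_comp (W \<union> P) W (relabel (inv_into (W \<union> P) dot) (Wd \<union> Pd) V2) VW))"
proof -
  let ?M1 = "matched_comp (W \<union> P) W V1 VW"
  let ?M2 = "matched_comp (W \<union> P) W (relabel (inv_into (W \<union> P) dot) (Wd \<union> Pd) V2) VW"
  have spaces: "VWWd \<subseteq> vectors_on (W \<union> Wd)" "VPPd \<subseteq> vectors_on (P \<union> Pd)"
      "V1 \<subseteq> vectors_on (W \<union> P)" "V2 \<subseteq> vectors_on (Wd \<union> Pd)"
    and VW: "VW \<subseteq> vectors_on W"
    using assms by (auto simp: space_on_def)
  have "?M2 \<subseteq> ?M1"
    by (rule matched_comp_mono[OF E_linkedD(1)[OF assms(17)]])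
  then have "(controlled_invariant dot W Wd VWWd VW \<longrightarrow> controlled_invariant dot P Pd VPPd K) \<and>
      (conditioned_invariant dot W Wd VWWd VW \<longrightarrow> conditioned_invariant dot P Pd VPPd K)"
    if "K = ?M1 \<or> K = ?M2" for K
    using that controlled_invariant_between[OF assms(5-12) spaces assms(17) VW, of K]
      conditioned_invariant_between[OF assms(5-12) spaces assms(17) VW, of K]
    by blast
  then show ?thesis
    unfolding invariant_def by blast
qed

end
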